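(* Consider a four-vortex collinear relative equilibrium with circulations $\Gamma_1,\dots,\Gamma_4$ and angular velocity $\omega$, and let $C$ be the restriction of the matrix $A$ to the invariant subspace $W^\perp$. Let $T$ and $D$ denote the trace and determinant, respectively, of $C$. Then $$T=\omega^{-1}\sum_{1\le i<j\le4}\frac{\Gamma_i+\Gamma_j}{r_{ij}^2}-1,\qquad D=-T+\omega^{-2}\delta .$$
   Context: Four vortices with circulations $\Gamma_i\neq0$, $\Gamma=\sum_i\Gamma_i\neq0$, at distinct positions $(x_i,0)$ on the $x$-axis, $r_{ij}=|x_i-x_j|$, forming a relative equilibrium with center of vorticity $\frac1\Gamma\sum_i\Gamma_ix_i$ at the origin and angular velocity $\omega\neq0$; i.e. $\sum_{j\neq i}\frac{\Gamma_j}{x_j-x_i}+\omega x_i=0$ for $i=1,\dots,4$. The $4\times 4$ matrix $A$ has entries $A_{ij}=-\omega^{-1}\Gamma_jr_{ij}^{-2}$ for $i\ne j$ and $A_{ii}=-\sum_{j\neq i}A_{ij}$. Let $s=[1,1,1,1]^T$, $x=[x_1,x_2,x_3,x_4]^T$ (eigenvectors of $A$ with eigenvalues $0$ and $1$), $W=\mathrm{span}\{s,x\}$, $M=\mathrm{diag}\{\Gamma_1,\Gamma_2,\Gamma_3,\Gamma_4\}$, and $W^\perp=\{w\in\mathbb{R}^4: w^TMv=0\ \forall v\in W\}$, a two-dimensional subspace invariant under $A$, with basis $$w_1=[\Gamma_2\Gamma_3(x_3-x_2),\,\Gamma_1\Gamma_3(x_1-x_3),\,\Gamma_1\Gamma_2(x_2-x_1),\,0]^T,$$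 $$w_2=[\Gamma_2\Gamma_4(x_4-x_2),\,\Gamma_1\Gamma_4(x_1-x_4),\,0,\,\Gamma_1\Gamma_2(x_2-x_1)]^T.$$ $C$ is the $2\times 2$ matrix of $A|_{W^\perp}$ in this basis. Finally, $$\delta=\frac{(\Gamma_1+\Gamma_2)(\Gamma_3+\Gamma_4)}{r_{12}^2r_{34}^2}+\frac{(\Gamma_1+\Gamma_3)(\Gamma_2+\Gamma_4)}{r_{13}^2r_{24}^2}+\frac{(\Gamma_1+\Gamma_4)(\Gamma_2+\Gamma_3)}{r_{14}^2r_{23}^2}+\sum_{i=1}^4\ \sum_{\substack{j<k\\ j,k\neq i}}\frac{\Gamma_i(\Gamma_i+\Gamma_j+\Gamma_k)}{r_{ij}^2r_{ik}^2}.$$ *)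

theory Defs
  imports "HOL-Analysis.Analysis"
begin

(* Vortices are indexed by the type 4, whose elements are 1, 2, 3 and 4 = 0. In its order 4 is
   the least element, so "i < j" picks each unordered pair of distinct indices exactly once, but
   not always with the usual orientation; it is used below only for summands symmetric in i, j. *)

lemma vector_4:
  "(vector [a, b, c, d] :: 'a::zero ^ 4) $ 1 = a"
  "(vector [a, b, c, d] :: 'a::zero ^ 4) $ 2 = b"
  "(vector [a, b, c, d] :: 'a::zero ^ 4) $ 3 = c"
  "(vector [a, b, c, d] :: 'a::zero ^ 4) $ 4 = d"
  unfolding vector_def by simp_all

definition rdist :: "real^4 \<Rightarrow> 4 \<Rightarrow> 4 \<Rightarrow> real" where
  "rdist x i j = \<bar>x $ i - x $ j\<bar>"

definition total_circulation :: "real^4 \<Rightarrow> real" where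
  "total_circulation \<Gamma> = (\<Sum>i\<in>UNIV. \<Gamma> $ i)"

definition collinear_relative_equilibrium :: "real^4 \<Rightarrow> real^4 \<Rightarrow> real \<Rightarrow> bool" where
  "collinear_relative_equilibrium \<Gamma> x \<omega> \<longleftrightarrow>
     (\<forall>i. \<Gamma> $ i \<noteq> 0) \<and> total_circulation \<Gamma> \<noteq> 0 \<and> \<omega> \<noteq> 0 \<and>
     (\<forall>i j. i \<noteq> j \<longrightarrow> x $ i \<noteq> x $ j) \<and>
     (1 / total_circulation \<Gamma>) * (\<Sum>i\<in>UNIV. \<Gamma> $ i * x $ i) = 0 \<and>
     (\<forall>i. (\<Sum>j\<in>UNIV - {i}. \<Gamma> $ j / (x $ j - x $ i)) + \<omega> * x $ i = 0)"

definition matA_offdiag :: "real^4 \<Rightarrow> real^4 \<Rightarrow> real \<Rightarrow> 4 \<Rightarrow> 4 \<Rightarrow> real" where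
  "matA_offdiag \<Gamma> x \<omega> i j = - inverse \<omega> * \<Gamma> $ j * inverse ((rdist x i j)\<^sup>2)"

definition matA :: "real^4 \<Rightarrow> real^4 \<Rightarrow> real \<Rightarrow> real^4^4" where
  "matA \<Gamma> x \<omega> = (\<chi> i j. if i = j then - (\<Sum>k\<in>UNIV - {i}. matA_offdiag \<Gamma> x \<omega> i k)
                       else matA_offdiag \<Gamma> x \<omega> i j)"

definition matM :: "real^4 \<Rightarrow> real^4^4" where
  "matM \<Gamma> = (\<chi> i j. if i = j then \<Gamma> $ i else 0)"

definition W :: "real^4 \<Rightarrow> (real^4) set" where
  "W x = span {vector [1, 1, 1, 1], x}"

definition Wperp :: "real^4 \<Rightarrow> real^4 \<Rightarrow> (real^4) set" where
  "Wperp \<Gamma> x = {w. \<forall>v\<in>W x. w \<bullet> (matM \<Gamma> *v v) = 0}"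

definition w1 :: "real^4 \<Rightarrow> real^4 \<Rightarrow> real^4" where
  "w1 \<Gamma> x = vector [\<Gamma>$2 * \<Gamma>$3 * (x$3 - x$2), \<Gamma>$1 * \<Gamma>$3 * (x$1 - x$3),
                    \<Gamma>$1 * \<Gamma>$2 * (x$2 - x$1), 0]"

definition w2 :: "real^4 \<Rightarrow> real^4 \<Rightarrow> real^4" where
  "w2 \<Gamma> x = vector [\<Gamma>$2 * \<Gamma>$4 * (x$4 - x$2), \<Gamma>$1 * \<Gamma>$4 * (x$1 - x$4),
                    0, \<Gamma>$1 * \<Gamma>$2 * (x$2 - x$1)]"

definition wbasis :: "real^4 \<Rightarrow> real^4 \<Rightarrow> 2 \<Rightarrow> real^4" where
  "wbasis \<Gamma> x k = (if k = 1 then w1 \<Gamma> x else w2 \<Gamma> x)"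

(* The matrix of A restricted to V in the ordered basis b of V; column j holds the coordinates
   of the image of b j. The last conjunct forces V to be A-invariant. If b is not a basis of V
   or V is not A-invariant, no matrix qualifies and the value is unspecified. *)
definition matrix_of_restriction ::
  "real^'n^'n \<Rightarrow> (real^'n) set \<Rightarrow> ('k::finite \<Rightarrow> real^'n) \<Rightarrow> real^'k^'k" where
  "matrix_of_restriction A V b = (THE C.
     inj b \<and> independent (range b) \<and> span (range b) = V \<and>
     (\<forall>j. A *v b j = (\<Sum>i\<in>UNIV. (C $ i $ j) *\<^sub>R b i)))"

definition matC :: "real^4 \<Rightarrow> real^4 \<Rightarrow> real \<Rightarrow> real^2^2" where
  "matC \<Gamma> x \<omega> = matrix_of_restriction (matA \<Gamma> x \<omega>) (Wperp \<Gamma> x) (wbasis \<Gamma> x)"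

definition delta :: "real^4 \<Rightarrow> real^4 \<Rightarrow> real" where
  "delta \<Gamma> x =
     (\<Gamma>$1 + \<Gamma>$2) * (\<Gamma>$3 + \<Gamma>$4) / ((rdist x 1 2)\<^sup>2 * (rdist x 3 4)\<^sup>2)
   + (\<Gamma>$1 + \<Gamma>$3) * (\<Gamma>$2 + \<Gamma>$4) / ((rdist x 1 3)\<^sup>2 * (rdist x 2 4)\<^sup>2)
   + (\<Gamma>$1 + \<Gamma>$4) * (\<Gamma>$2 + \<Gamma>$3) / ((rdist x 1 4)\<^sup>2 * (rdist x 2 3)\<^sup>2)
   + (\<Sum>i\<in>UNIV. \<Sum>(j, k)\<in>{(j, k). j < k \<and> j \<noteq> i \<and> k \<noteq> i}.
        \<Gamma>$i * (\<Gamma>$i + \<Gamma>$j + \<Gamma>$k) / ((rdist x i j)\<^sup>2 * (rdist x i k)\<^sup>2))"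

end

theory Submission
  imports Defs
begin

text \<open>
  \<open>A\<close> is symmetric for the bilinear form \<open>M\<close>, so the rows \<open>s\<^sup>T M\<close> and \<open>x\<^sup>T M\<close>, which cut out
  \<open>W\<^sup>\<bottom>\<close>, are left eigenvectors of \<open>A\<close> with eigenvalues \<open>0\<close> and \<open>1\<close>. Hence \<open>A\<close> acts on the
  quotient of \<open>\<real>\<^sup>4\<close> by \<open>W\<^sup>\<bottom>\<close> with eigenvalues \<open>0\<close> and \<open>1\<close>; the quotient is used instead of \<open>W\<close>
  because \<open>W\<close> meets \<open>W\<^sup>\<bottom>\<close> nontrivially when \<open>\<Sum>\<^sub>i \<Gamma>\<^sub>i x\<^sub>i\<^sup>2 = 0\<close>. The first two elementary symmetric functions
  of the eigenvalues of \<open>A\<close> are therefore \<open>T + 1\<close> and \<open>D + T\<close>, and they equal the trace and the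
  sum of the principal \<open>2\<times>2\<close> minors of \<open>A\<close>.
\<close>

section \<open>Sums over the four indices and over pairs of them\<close>

lemma less_4 [simp]:
  "(1::4) < 2" "(1::4) < 3" "(2::4) < 3" "(4::4) < 1" "(4::4) < 2" "(4::4) < 3"
  "\<not> (2::4) < 1" "\<not> (3::4) < 1" "\<not> (3::4) < 2"
  "\<not> (1::4) < 4" "\<not> (2::4) < 4" "\<not> (3::4) < 4"
  by (simp_all add: less_bit0_def bit0.Rep_numeral bit0.Rep_1 bit0.Rep_0)

lemma sum_less_pairs_4:
  "(\<Sum>(i, j)\<in>{(i, j). i < j \<and> P i j}. f i j) =
     (\<Sum>i\<in>UNIV. \<Sum>j\<in>UNIV. if i < (j::4) \<and> P i j then f i j else (0::real))"
proof -
  have "{(i, j). i < j \<and> P i j} = (SIGMA i:UNIV. {j. i < j \<and> P i j})" by auto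
  then show ?thesis
    by (simp add: sum.Sigma[symmetric] sum.If_cases)
qed

lemma sum_diff_4:
  "(\<Sum>j\<in>UNIV - {1::4}. f j) = f 2 + f 3 + f 4"
  "(\<Sum>j\<in>UNIV - {2::4}. f j) = f 1 + f 3 + f 4"
  "(\<Sum>j\<in>UNIV - {3::4}. f j) = f 1 + f 2 + f 4"
  "(\<Sum>j\<in>UNIV - {4::4}. f j) = f 1 + f 2 + (f 3 :: 'a::ab_group_add)"
  by (simp_all add: sum_diff1 sum_4 algebra_simps)

section \<open>Trace and minors of a matrix with an invariant plane\<close>

definition minors2 :: "real^4^4 \<Rightarrow> real" where
  "minors2 A = (\<Sum>(i, j)\<in>{(i, j). i < j}. A$i$i * A$j$j - A$i$j * A$j$i)"

lemma minors2_explicit: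
  "minors2 A = A$1$1 * A$2$2 - A$1$2 * A$2$1 + (A$1$1 * A$3$3 - A$1$3 * A$3$1)
     + (A$1$1 * A$4$4 - A$1$4 * A$4$1) + (A$2$2 * A$3$3 - A$2$3 * A$3$2)
     + (A$2$2 * A$4$4 - A$2$4 * A$4$2) + (A$3$3 * A$4$4 - A$3$4 * A$4$3)"
  unfolding minors2_def
  using sum_less_pairs_4[where P = "\<lambda>_ _. True" and f = "\<lambda>i j. A$i$i * A$j$j - A$i$j * A$j$i"]
  by (simp add: sum_4)

text \<open>In the basis \<open>b1\<close>, \<open>b2\<close>, \<open>e1\<close>, \<open>e2\<close>
  (the last two being unit vectors) \<open>A\<close> is block triangular with diagonal blocks
  \<open>C\<close> and a 2x2 matrix \<open>E\<close>. The covectors \<open>l\<close> and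
  \<open>m\<close> give \<open>E\<close> the eigenvalues 0 and 1, and trace and
  \<open>minors2\<close> are coefficients of the characteristic polynomial up to sign.\<close>

lemma trace_minors2_restriction:
  fixes A :: "real^4^4" and C :: "real^2^2" and b1 b2 l m :: "real^4"
  assumes b: "b1$3 = c" "b1$4 = 0" "b2$3 = 0" "b2$4 = c" "c \<noteq> 0"
    and C: "A *v b1 = C$1$1 *\<^sub>R b1 + C$2$1 *\<^sub>R b2" "A *v b2 = C$1$2 *\<^sub>R b1 + C$2$2 *\<^sub>R b2"
    and orth: "l \<bullet> b1 = 0" "l \<bullet> b2 = 0" "m \<bullet> b1 = 0" "m \<bullet> b2 = 0"
    and eig: "l v* A = 0" "m v* A = m"
    and indep: "l$1 * m$2 \<noteq> l$2 * m$1"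
  shows "trace A = trace C + 1" "minors2 A = det C + trace C"
proof -
  \<comment> \<open>Dividing by \<open>c\<close> turns \<open>b1\<close> and \<open>b2\<close> into
    (p, q, 1, 0) and (r, s, 0, 1), so components 3 and 4 of a vector in their span are its
    coordinates.\<close>
  define p q r s where "p = b1$1 / c" and "q = b1$2 / c" and "r = b2$1 / c" and "s = b2$2 / c"
  have b': "b1$1 = c * p" "b1$2 = c * q" "b2$1 = c * r" "b2$2 = c * s"
    using \<open>c \<noteq> 0\<close> by (simp_all add: p_def q_def r_def s_def)
  have "c * (A$i$1 * p + A$i$2 * q + A$i$3) = (A *v b1) $ i"
       "c * (A$i$1 * r + A$i$2 * s + A$i$4) = (A *v b2) $ i" for i
    by (simp_all add: matrix_vector_mult_def sum_4 b b' algebra_simps)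
  then have Ab: "c * (A$i$1 * p + A$i$2 * q + A$i$3) = C$1$1 * b1$i + C$2$1 * b2$i"
       "c * (A$i$1 * r + A$i$2 * s + A$i$4) = C$1$2 * b1$i + C$2$2 * b2$i" for i
    by (simp_all add: C)
  have C': "C$1$1 = A$3$1 * p + A$3$2 * q + A$3$3" "C$2$1 = A$4$1 * p + A$4$2 * q + A$4$3"
           "C$1$2 = A$3$1 * r + A$3$2 * s + A$3$4" "C$2$2 = A$4$1 * r + A$4$2 * s + A$4$4"
    using Ab(1)[of 3] Ab(1)[of 4] Ab(2)[of 3] Ab(2)[of 4] \<open>c \<noteq> 0\<close> by (simp_all add: b)
  have "c * (A$1$1 * p + A$1$2 * q + A$1$3) = c * (C$1$1 * p + C$2$1 * r)"
       "c * (A$2$1 * p + A$2$2 * q + A$2$3) = c * (C$1$1 * q + C$2$1 * s)"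
       "c * (A$1$1 * r + A$1$2 * s + A$1$4) = c * (C$1$2 * p + C$2$2 * r)"
       "c * (A$2$1 * r + A$2$2 * s + A$2$4) = c * (C$1$2 * q + C$2$2 * s)"
    using Ab(1)[of 1] Ab(1)[of 2] Ab(2)[of 1] Ab(2)[of 2] unfolding b' by (simp_all add: algebra_simps)
  then have Z: "A$1$3 = C$1$1 * p + C$2$1 * r - A$1$1 * p - A$1$2 * q"
       "A$2$3 = C$1$1 * q + C$2$1 * s - A$2$1 * p - A$2$2 * q"
       "A$1$4 = C$1$2 * p + C$2$2 * r - A$1$1 * r - A$1$2 * s"
       "A$2$4 = C$1$2 * q + C$2$2 * s - A$2$1 * r - A$2$2 * s"
    using \<open>c \<noteq> 0\<close> by simp_all
  \<comment> \<open>\<open>E\<close> is the matrix of \<open>A\<close> on the quotient by the span of \<open>b1\<close>, \<open>b2\<close>, in the classes of the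
    first two unit vectors; \<open>l\<close> and \<open>m\<close> restrict to its left eigenvectors.\<close>
  define E11 E12 E21 E22 where "E11 = A$1$1 - p * A$3$1 - r * A$4$1"
    and "E12 = A$1$2 - p * A$3$2 - r * A$4$2"
    and "E21 = A$2$1 - q * A$3$1 - s * A$4$1"
    and "E22 = A$2$2 - q * A$3$2 - s * A$4$2"
  note E_defs = E11_def E12_def E21_def E22_def
  have row: "v$3 = - (v$1 * p + v$2 * q)" "v$4 = - (v$1 * r + v$2 * s)"
    if "v \<bullet> b1 = 0" "v \<bullet> b2 = 0" for v
  proof -
    have "c * (v$1 * p + v$2 * q + v$3) = 0" "c * (v$1 * r + v$2 * s + v$4) = 0"
      using that by (simp_all add: inner_vec_def sum_4 b b' algebra_simps)
    then show "v$3 = - (v$1 * p + v$2 * q)" "v$4 = - (v$1 * r + v$2 * s)"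
      using \<open>c \<noteq> 0\<close> by auto
  qed
  have vE: "v$1 * E11 + v$2 * E21 = (v v* A) $ 1" "v$1 * E12 + v$2 * E22 = (v v* A) $ 2"
    if "v \<bullet> b1 = 0" "v \<bullet> b2 = 0" for v
    by (simp_all add: vector_matrix_mult_def sum_4 E_defs row[OF that] algebra_simps)
  have lE: "l$1 * E11 + l$2 * E21 = 0" "l$1 * E12 + l$2 * E22 = 0"
    using vE[OF orth(1,2)] by (simp_all add: eig)
  have mE: "m$1 * E11 + m$2 * E21 = m$1" "m$1 * E12 + m$2 * E22 = m$2"
    using vE[OF orth(3,4)] by (simp_all add: eig)
  \<comment> \<open>With P the matrix of rows (l1, l2) and (m1, m2), P E = diag(0, 1) P. The first
    factor is det P, nonzero by \<open>indep\<close>.\<close>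
  have "(l$1 * m$2 - l$2 * m$1) * (E11 + E22 - 1) = 0"
    using lE mE by algebra
  then have trE: "E11 + E22 = 1" using indep by simp
  have "(l$1 * m$2 - l$2 * m$1) * (E11 * E22 - E12 * E21) = 0"
    using lE by algebra
  then have detE: "E11 * E22 - E12 * E21 = 0" using indep by simp
  show "trace A = trace C + 1"
    using trE by (simp add: trace_def sum_4 sum_2 C' E_defs algebra_simps)
  \<comment> \<open>This is the second elementary symmetric function of a block triangular matrix,
    from its blocks \<open>C\<close> and \<open>E\<close>.\<close>
  have "minors2 A = det C + (C$1$1 + C$2$2) * (E11 + E22) + (E11 * E22 - E12 * E21)"
    unfolding minors2_explicit det_2 E_defs
    using C' Z by algebra
  then show "minors2 A = det C + trace C"
    by (simp add: trE detE trace_def sum_2)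
qed

section \<open>Right and left eigenvectors of \<open>A\<close>, and the invariance of
  \<open>Wperp\<close>\<close>

lemma matA_mult_component:
  "(matA \<Gamma> x \<omega> *v v) $ i = (\<Sum>j\<in>UNIV - {i}. matA_offdiag \<Gamma> x \<omega> i j * (v$j - v$i))"
proof -
  have "(matA \<Gamma> x \<omega> *v v) $ i = matA \<Gamma> x \<omega> $i$i * v$i + (\<Sum>j\<in>UNIV - {i}. matA \<Gamma> x \<omega> $i$j * v$j)"
    by (simp add: matrix_vector_mult_def sum.remove)
  also have "(\<Sum>j\<in>UNIV - {i}. matA \<Gamma> x \<omega> $i$j * v$j)
      = (\<Sum>j\<in>UNIV - {i}. matA_offdiag \<Gamma> x \<omega> i j * v$j)"
    by (intro sum.cong) (auto simp: matA_def)
  finally show ?thesis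
    by (simp add: matA_def algebra_simps sum_subtractf sum_distrib_left)
qed

lemma matA_symmetric: "\<Gamma>$i * matA \<Gamma> x \<omega> $i$j = \<Gamma>$j * matA \<Gamma> x \<omega> $j$i"
  by (simp add: matA_def matA_offdiag_def rdist_def abs_minus_commute)

text \<open>Symmetry of \<open>A\<close> for the form \<open>M\<close> turns a right eigenvector v
  into the left eigenvector M v with the same eigenvalue.\<close>

lemma weighted_vector_matA:
  "(\<chi> i. \<Gamma>$i * v$i) v* matA \<Gamma> x \<omega> = (\<chi> i. \<Gamma>$i * (matA \<Gamma> x \<omega> *v v)$i)"
  unfolding vec_eq_iff vector_matrix_mult_def matrix_vector_mult_def
  by (auto simp: sum_distrib_left mult_ac intro!: sum.cong)
     (metis matA_symmetric mult.left_commute)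

lemma matA_ones: "matA \<Gamma> x \<omega> *v 1 = 0"
  by (simp add: vec_eq_iff matA_mult_component)

text \<open>Since (x_j - x_i) / r_ij^2 = 1 / (x_j - x_i), this is the equilibrium equation divided
  by \<open>\<omega>\<close>.\<close>

lemma matA_position:
  assumes "collinear_relative_equilibrium \<Gamma> x \<omega>"
  shows "matA \<Gamma> x \<omega> *v x = x"
proof -
  have ne: "x$i \<noteq> x$j" if "i \<noteq> j" for i j
    using assms that by (auto simp: collinear_relative_equilibrium_def)
  have "(matA \<Gamma> x \<omega> *v x) $ i = x $ i" for i
  proof -
    have "matA_offdiag \<Gamma> x \<omega> i j * (x$j - x$i) = - inverse \<omega> * (\<Gamma>$j / (x$j - x$i))"
      if "j \<in> UNIV - {i}" for j
      using ne[of j i] that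
      by (simp add: matA_offdiag_def rdist_def power2_eq_square divide_simps) (simp add: algebra_simps)
    then have "(matA \<Gamma> x \<omega> *v x) $ i = - inverse \<omega> * (\<Sum>j\<in>UNIV - {i}. \<Gamma>$j / (x$j - x$i))"
      unfolding matA_mult_component sum_distrib_left by (intro sum.cong) auto
    also have "(\<Sum>j\<in>UNIV - {i}. \<Gamma>$j / (x$j - x$i)) = - \<omega> * x$i"
      using assms by (simp add: collinear_relative_equilibrium_def eq_neg_iff_add_eq_0)
    finally show ?thesis
      using assms by (simp add: collinear_relative_equilibrium_def)
  qed
  then show ?thesis by (simp add: vec_eq_iff)
qed

lemma Wperp_iff:
  "w \<in> Wperp \<Gamma> x \<longleftrightarrow> \<Gamma> \<bullet> w = 0 \<and> (\<chi> i. \<Gamma>$i * x$i) \<bullet> w = 0"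
proof -
  have Mv: "matM \<Gamma> *v v = (\<chi> i. \<Gamma>$i * v$i)" for v
    by (simp add: vec_eq_iff matM_def matrix_vector_mult_def mult_delta_left)
  have s: "(vector [1, 1, 1, 1] :: real^4) = 1"
    by (simp add: vec_eq_iff forall_4 vector_4)
  have "subspace {v. w \<bullet> (matM \<Gamma> *v v) = 0}"
    by (auto simp: subspace_def matrix_vector_right_distrib inner_add_right
        matrix_vector_mult_scaleR)
  then have "(\<forall>v\<in>W x. w \<bullet> (matM \<Gamma> *v v) = 0) \<longleftrightarrow> (\<forall>v\<in>{1, x}. w \<bullet> (matM \<Gamma> *v v) = 0)"
    unfolding W_def s by (metis (mono_tags, lifting) mem_Collect_eq span_base span_minimal subsetD subsetI)
  moreover have "(\<chi> i. \<Gamma>$i * (1::real^4)$i) = \<Gamma>" by (simp add: vec_eq_iff)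
  ultimately show ?thesis
    by (simp add: Wperp_def Mv inner_commute)
qed

lemma Wperp_invariant:
  assumes "collinear_relative_equilibrium \<Gamma> x \<omega>" "w \<in> Wperp \<Gamma> x"
  shows "matA \<Gamma> x \<omega> *v w \<in> Wperp \<Gamma> x"
proof -
  have "\<Gamma> v* matA \<Gamma> x \<omega> = 0"
    using weighted_vector_matA[of \<Gamma> 1 x \<omega>] by (simp add: matA_ones zero_vec_def)
  moreover have "(\<chi> i. \<Gamma>$i * x$i) v* matA \<Gamma> x \<omega> = (\<chi> i. \<Gamma>$i * x$i)"
    using weighted_vector_matA[of \<Gamma> x x \<omega>] matA_position[OF assms(1)] by simp
  ultimately show ?thesis
    using assms(2) by (simp add: Wperp_iff flip: dot_lmul_matrix)
qed

section \<open>Coordinates in \<open>Wperp\<close> and the defining property of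
  \<open>matC\<close>\<close>

lemma w1_w2_components:
  "w1 \<Gamma> x $ 3 = \<Gamma>$1 * \<Gamma>$2 * (x$2 - x$1)" "w1 \<Gamma> x $ 4 = 0"
  "w2 \<Gamma> x $ 3 = 0" "w2 \<Gamma> x $ 4 = \<Gamma>$1 * \<Gamma>$2 * (x$2 - x$1)"
  by (simp_all add: w1_def w2_def vector_4)

text \<open>The entries of \<open>w1\<close> at 1, 2, 3 form the cross product of those of
  \<open>\<Gamma>\<close> and of the vector of the \<open>\<Gamma>$i * x$i\<close>; for
  \<open>w2\<close> the index 4 replaces 3.\<close>

lemma w1_w2_in_Wperp: "w1 \<Gamma> x \<in> Wperp \<Gamma> x" "w2 \<Gamma> x \<in> Wperp \<Gamma> x"
  by (simp_all add: Wperp_iff w1_def w2_def inner_vec_def sum_4 vector_4 algebra_simps)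

lemma Wperp_coordinates:
  fixes \<Gamma> x w :: "real^4"
  defines "c \<equiv> \<Gamma>$1 * \<Gamma>$2 * (x$2 - x$1)"
  assumes "w \<in> Wperp \<Gamma> x" "c \<noteq> 0"
  shows "w = (w$3 / c) *\<^sub>R w1 \<Gamma> x + (w$4 / c) *\<^sub>R w2 \<Gamma> x"
proof -
  define d where "d = w - ((w$3 / c) *\<^sub>R w1 \<Gamma> x + (w$4 / c) *\<^sub>R w2 \<Gamma> x)"
  have "d \<in> Wperp \<Gamma> x"
    using assms(2) w1_w2_in_Wperp[of \<Gamma> x] by (simp add: d_def Wperp_iff inner_diff_right inner_add_right)
  moreover have d34: "d$3 = 0" "d$4 = 0"
    using \<open>c \<noteq> 0\<close> by (simp_all add: d_def w1_w2_components flip: c_def)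
  ultimately have *: "\<Gamma>$1 * d$1 + \<Gamma>$2 * d$2 = 0"
      "\<Gamma>$1 * x$1 * d$1 + \<Gamma>$2 * x$2 * d$2 = 0"
    unfolding Wperp_iff inner_vec_def sum_4 by simp_all
  \<comment> \<open>The two equations for \<open>d$1\<close> and \<open>d$2\<close> have determinant
    \<open>c\<close>.\<close>
  have "c * d$1 = 0" "c * d$2 = 0"
    unfolding c_def using * by (algebra, algebra)
  then have "d = 0"
    using d34 \<open>c \<noteq> 0\<close> by (simp add: vec_eq_iff forall_4)
  then show ?thesis by (simp add: d_def)
qed

lemma wbasis_basis:
  assumes "\<Gamma>$1 * \<Gamma>$2 * (x$2 - x$1) \<noteq> 0"
  shows "inj (wbasis \<Gamma> x)" "independent (range (wbasis \<Gamma> x))"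
    "span (range (wbasis \<Gamma> x)) = Wperp \<Gamma> x"
proof -
  have ne: "w1 \<Gamma> x \<noteq> w2 \<Gamma> x"
    using assms w1_w2_components[of \<Gamma> x] by metis
  have range: "range (wbasis \<Gamma> x) = {w1 \<Gamma> x, w2 \<Gamma> x}"
    by (auto simp: wbasis_def UNIV_2)
  show "inj (wbasis \<Gamma> x)"
    using ne by (auto simp: inj_def wbasis_def forall_2)
  have "w1 \<Gamma> x \<noteq> k *\<^sub>R w2 \<Gamma> x" "w2 \<Gamma> x \<noteq> 0" for k
    using assms w1_w2_components[of \<Gamma> x] by (metis mult_zero_right vector_scaleR_component real_scaleR_def, metis zero_index)
  then show "independent (range (wbasis \<Gamma> x))"
    unfolding range using ne by (auto simp: independent_insert span_singleton)
  have "subspace (Wperp \<Gamma> x)"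
    by (auto simp: subspace_def Wperp_iff inner_add_right)
  then show "span (range (wbasis \<Gamma> x)) = Wperp \<Gamma> x"
  proof (intro equalityI span_minimal subsetI)
    fix w assume "w \<in> Wperp \<Gamma> x"
    from Wperp_coordinates[OF this assms] show "w \<in> span (range (wbasis \<Gamma> x))"
      unfolding range by (metis insertI1 insertI2 span_add span_base span_scale)
  qed (auto simp: range w1_w2_in_Wperp)
qed

text \<open>Justifies the definite description: invariance of \<open>V\<close> yields a matrix,
  independence of the basis makes it unique.\<close>

lemma matrix_of_restriction_mult:
  fixes b :: "'k::finite \<Rightarrow> real^'n"
  assumes basis: "inj b" "independent (range b)" "span (range b) = V"
    and inv: "\<And>v. v \<in> V \<Longrightarrow> A *v v \<in> V"
  shows "A *v b j = (\<Sum>i\<in>UNIV. matrix_of_restriction A V b $ i $ j *\<^sub>R b i)"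
proof -
  let ?P = "\<lambda>C::real^'k^'k. inj b \<and> independent (range b) \<and> span (range b) = V \<and>
     (\<forall>j. A *v b j = (\<Sum>i\<in>UNIV. (C $ i $ j) *\<^sub>R b i))"
  have "\<exists>u. A *v b j = (\<Sum>i\<in>UNIV. u i *\<^sub>R b i)" for j
  proof -
    have "A *v b j \<in> span (range b)"
      using basis(3) inv[of "b j"] by (auto intro: span_base)
    then obtain u where "A *v b j = (\<Sum>v\<in>range b. u v *\<^sub>R v)"
      by (auto simp: span_finite)
    then show ?thesis
      by (auto simp: sum.reindex[OF basis(1)])
  qed
  then obtain u where u: "\<And>j. A *v b j = (\<Sum>i\<in>UNIV. u j i *\<^sub>R b i)"
    by metis
  have "\<exists>!C. ?P C"
  proof
    show "?P (\<chi> i j. u j i)"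
      using basis u by simp
  next
    fix C assume C: "?P C"
    have "C $ i $ j = u j i" for i j
    proof -
      have "(\<Sum>i\<in>UNIV. (C $ i $ j - u j i) *\<^sub>R b i) = 0"
        using C u[of j] by (simp add: scaleR_diff_left sum_subtractf)
      then have "(\<Sum>v\<in>range b. (C $ (inv b v) $ j - u j (inv b v)) *\<^sub>R v) = 0"
        by (simp add: sum.reindex[OF basis(1)] inv_f_f[OF basis(1)])
      from independentD[OF basis(2) _ subset_refl this, of "b i"]
      show ?thesis by (simp add: inv_f_f[OF basis(1)])
    qed
    then show "C = (\<chi> i j. u j i)" by (simp add: vec_eq_iff)
  qed
  from theI'[OF this] show ?thesis
    unfolding matrix_of_restriction_def by blast
qed

section \<open>Trace and minors of \<open>A\<close> in terms of circulations and distances\<close>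

lemma rdist_commute: "rdist x i j = rdist x j i"
  by (simp add: rdist_def abs_minus_commute)

lemma trace_matA:
  "trace (matA \<Gamma> x \<omega>) =
     inverse \<omega> * (\<Sum>(i, j)\<in>{(i, j). i < j}. (\<Gamma> $ i + \<Gamma> $ j) / (rdist x i j)\<^sup>2)"
  using sum_less_pairs_4[where P = "\<lambda>_ _. True" and f = "\<lambda>i j. (\<Gamma> $ i + \<Gamma> $ j) / (rdist x i j)\<^sup>2"]
  by (simp add: trace_def sum_4 matA_def matA_offdiag_def sum_diff_4 rdist_commute[of x 2 1]
      rdist_commute[of x 3 1] rdist_commute[of x 3 2] rdist_commute[of x 4]
      divide_inverse algebra_simps)

text \<open>In each minor the r_ij^(-4) terms cancel. The remaining products of two distinct edges
  give the first three terms of \<open>delta\<close> when the edges are disjoint, and the triple sum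
  when they share the vertex i.\<close>

lemma minors2_matA:
  "minors2 (matA \<Gamma> x \<omega>) = inverse (\<omega>\<^sup>2) * delta \<Gamma> x"
  unfolding minors2_explicit delta_def sum_less_pairs_4
  by (simp add: sum_4 matA_def matA_offdiag_def sum_diff_4 rdist_commute[of x 2 1]
      rdist_commute[of x 3 1] rdist_commute[of x 3 2] rdist_commute[of x 4]
      divide_inverse power2_eq_square[of \<omega>] algebra_simps)

theorem lemma3p3:
  fixes \<Gamma> x :: "real^4" and \<omega> T D :: real and C :: "real^2^2"
  assumes "collinear_relative_equilibrium \<Gamma> x \<omega>"
    and "C = matC \<Gamma> x \<omega>"
    and "T = trace C"
    and "D = det C"
  shows "T = inverse \<omega> * (\<Sum>(i, j)\<in>{(i, j). i < j}. (\<Gamma> $ i + \<Gamma> $ j) / (rdist x i j)\<^sup>2) - 1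
       \<and> D = - T + inverse (\<omega>\<^sup>2) * delta \<Gamma> x"
proof -
  let ?A = "matA \<Gamma> x \<omega>" and ?m = "\<chi> i. \<Gamma>$i * x$i" and ?c = "\<Gamma>$1 * \<Gamma>$2 * (x$2 - x$1)"
  have ne: "\<And>i. \<Gamma>$i \<noteq> 0" "x$2 \<noteq> x$1"
    using assms(1) by (simp_all add: collinear_relative_equilibrium_def)
  then have c: "?c \<noteq> 0" by simp
  have mult: "?A *v wbasis \<Gamma> x j = (\<Sum>i\<in>UNIV. C$i$j *\<^sub>R wbasis \<Gamma> x i)" for j
    unfolding assms(2) matC_def
    by (intro matrix_of_restriction_mult wbasis_basis c Wperp_invariant assms(1))
  have C: "?A *v w1 \<Gamma> x = C$1$1 *\<^sub>R w1 \<Gamma> x + C$2$1 *\<^sub>R w2 \<Gamma> x"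
    "?A *v w2 \<Gamma> x = C$1$2 *\<^sub>R w1 \<Gamma> x + C$2$2 *\<^sub>R w2 \<Gamma> x"
    using mult[of 1] mult[of 2] by (simp_all add: wbasis_def sum_2)
  have orth: "\<Gamma> \<bullet> w1 \<Gamma> x = 0" "\<Gamma> \<bullet> w2 \<Gamma> x = 0" "?m \<bullet> w1 \<Gamma> x = 0" "?m \<bullet> w2 \<Gamma> x = 0"
    using w1_w2_in_Wperp[of \<Gamma> x] by (simp_all add: Wperp_iff)
  have "\<Gamma> v* ?A = 0" "?m v* ?A = ?m"
    using weighted_vector_matA[of \<Gamma> 1 x \<omega>] weighted_vector_matA[of \<Gamma> x x \<omega>]
    by (simp_all add: matA_ones matA_position[OF assms(1)] zero_vec_def)
  \<comment> \<open>The difference of the two sides is \<open>?c\<close>.\<close>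
  moreover have "\<Gamma>$1 * ?m$2 \<noteq> \<Gamma>$2 * ?m$1"
    using ne by simp
  ultimately have "trace ?A = trace C + 1" "minors2 ?A = det C + trace C"
    using trace_minors2_restriction[OF w1_w2_components c C orth] by blast+
  then show ?thesis
    unfolding assms(3,4) trace_matA minors2_matA by simp
qed

end
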